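(* (Modified Kirchhoff model, genuine nonlinearity.) Let $\lambda,\mu,\rho_0>0$, put $\alpha=\lambda/\mu$, and, writing $s=1+\Gamma>0$, let $$P=\frac1{\rho_0}\Big(\mu s^3-\mu s+\lambda\frac{\ln s}{s}\Big).$$ Let $$s_\alpha=\Big[\frac{\alpha}{12}\,W_L\Big(\frac{12e^6}{\alpha}\Big)\Big]^{1/4},$$ where $W_L:[0,\infty)\to[0,\infty)$ is the inverse of the function $w\mapsto we^w$ on $[0,\infty)$. Then, for $s>0$, $P''(s)<0$ holds if and only if $s\in(0,s_\alpha)$. Consequently $P''(s)<0$ holds for all $s\in(0,1]$ if and only if $s_\alpha>1$, which is equivalent to $\alpha>2$.
   Context: Primes denote derivatives with respect to $s$ (equivalently $\Gamma=s-1$). The condition $P''<0$ is the genuine nonlinearity condition for the p-system $V_t-(P(\Gamma))_X=0$, $\Gamma_t-V_X=0$, $\Gamma>-1$. *)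

theory Defs
  imports "HOL-Analysis.Analysis"
begin

text \<open>The stress of the modified Kirchhoff model as a function of the stretch s = 1 + Gamma.
  Only its values for s > 0 are meaningful.\<close>

definition kirchhoff_P :: "real \<Rightarrow> real \<Rightarrow> real \<Rightarrow> real \<Rightarrow> real" where
  "kirchhoff_P lam mu rho0 s = 1 / rho0 * (mu * s ^ 3 - mu * s + lam * (ln s / s))"

definition lambert_W :: "real \<Rightarrow> real" where
  "lambert_W = the_inv_into {0..} (\<lambda>w. w * exp w)"

definition s_crit :: "real \<Rightarrow> real" where
  "s_crit \<alpha> = (\<alpha> / 12 * lambert_W (12 * exp 6 / \<alpha>)) powr (1 / 4)"

lemma bij_betw_times_exp: "bij_betw (\<lambda>w::real. w * exp w) {0..} {0..}"
proof -
  have "strict_mono_on {0..} (\<lambda>w::real. w * exp w)"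
    by (intro strict_mono_onI mult_strict_mono) auto
  then have "inj_on (\<lambda>w::real. w * exp w) {0..}"
    by (rule strict_mono_on_imp_inj_on)
  moreover have "(\<lambda>w::real. w * exp w) ` {0..} = {0..}"
  proof (intro subset_antisym subsetI)
    fix y :: real assume y: "y \<in> {0..}"
    then have "y \<le> y * exp y"
      by (simp add: mult_le_cancel_left1)
    then have "\<exists>w. 0 \<le> w \<and> w \<le> y \<and> w * exp w = y"
      using y by (intro IVT') (auto intro!: continuous_intros)
    then show "y \<in> (\<lambda>w. w * exp w) ` {0..}"
      by (metis atLeast_iff imageI)
  qed auto
  ultimately show ?thesis
    by (simp add: bij_betw_def)
qed

lemma bij_betw_lambert_W: "bij_betw lambert_W {0..} {0..}"
  unfolding lambert_W_def by (rule bij_betw_the_inv_into[OF bij_betw_times_exp])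

end

theory Submission
  imports Defs
begin

text \<open>The sign of P'' at s is that of 6 s^4 + \<alpha> (2 ln s - 3). With w = 12 s^4 / \<alpha>, negativity
  says w + ln (s^4) < 6, and exponentiating gives w exp w < 12 exp 6 / \<alpha>, that is,
  w < W (12 exp 6 / \<alpha>). Evaluation at s = 1 yields the threshold \<alpha> = 2.\<close>

lemma lambert_W_nonneg: "0 \<le> x \<Longrightarrow> 0 \<le> lambert_W x"
  using bij_betw_apply[OF bij_betw_lambert_W, of x] by simp

lemma lambert_W_times_exp: "0 \<le> x \<Longrightarrow> lambert_W x * exp (lambert_W x) = x"
  unfolding lambert_W_def
  using f_the_inv_into_f_bij_betw[OF bij_betw_times_exp] by simp

lemma times_exp_less_iff:
  fixes v w :: real
  assumes "0 \<le> v" "0 \<le> w"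
  shows "v * exp v < w * exp w \<longleftrightarrow> v < w"
proof
  assume "v < w"
  then show "v * exp v < w * exp w"
    using assms by (intro mult_strict_mono) auto
next
  assume less: "v * exp v < w * exp w"
  show "v < w"
  proof (rule ccontr)
    assume "\<not> v < w"
    then have "w * exp w \<le> v * exp v"
      using assms by (intro mult_mono) auto
    with less show False by simp
  qed
qed

text \<open>Applying the increasing map \<open>w * exp w\<close> to both sides removes
  \<open>lambert_W\<close>, which is its right inverse on [0, \<infinity>). After this only
  elementary inequalities remain.\<close>

lemma less_lambert_W_iff:
  assumes "0 \<le> w" "0 \<le> x"
  shows "w < lambert_W x \<longleftrightarrow> w * exp w < x"
  using times_exp_less_iff[OF assms(1) lambert_W_nonneg[OF assms(2)]]
  by (simp add: lambert_W_times_exp[OF assms(2)])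

lemma less_powr_fourth_root_iff:
  fixes s y :: real
  assumes "0 < s" "0 \<le> y"
  shows "s < y powr (1 / 4) \<longleftrightarrow> s ^ 4 < y"
proof -
  have "(y powr (1 / 4)) ^ 4 = y"
    using assms(2) by (cases "y = 0") (auto simp: powr_power)
  then show ?thesis
    using power_mono_iff[of "y powr (1 / 4)" s 4] assms(1) by (simp flip: not_le)
qed

lemma less_s_crit_iff:
  assumes "0 < \<alpha>" "0 < s"
  shows "s < s_crit \<alpha> \<longleftrightarrow> 6 * s ^ 4 + \<alpha> * (2 * ln s - 3) < 0"
proof -
  \<comment> \<open>Dividing the inequality for \<open>s ^ 4\<close> by \<alpha> / 12 isolates the
    value of \<open>lambert_W\<close>; \<open>w\<close> is what the other side becomes.\<close>
  define w where "w = 12 * s ^ 4 / \<alpha>"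
  have "0 \<le> w" using assms by (simp add: w_def)
  have "s < s_crit \<alpha> \<longleftrightarrow> s ^ 4 < \<alpha> / 12 * lambert_W (12 * exp 6 / \<alpha>)"
    unfolding s_crit_def using assms
    by (intro less_powr_fourth_root_iff) (auto intro!: mult_nonneg_nonneg lambert_W_nonneg)
  also have "\<dots> \<longleftrightarrow> w < lambert_W (12 * exp 6 / \<alpha>)"
    using assms by (simp add: w_def field_simps)
  also have "\<dots> \<longleftrightarrow> w * exp w < 12 * exp 6 / \<alpha>"
    using \<open>0 \<le> w\<close> assms by (intro less_lambert_W_iff) auto
  \<comment> \<open>The positive factor 12 / \<alpha> occurs on both sides and cancels.\<close>
  also have "\<dots> \<longleftrightarrow> s ^ 4 * exp w < exp 6"
    using assms by (simp add: w_def field_simps)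
  also have "s ^ 4 * exp w = exp (4 * ln s + w)"
    using assms exp_of_nat_mult[of 4 "ln s"] by (simp add: exp_add)
  \<comment> \<open>By monotonicity of \<open>exp\<close> this compares the exponents: 4 ln s + 12
    s^4 / \<alpha> < 6. Multiplying by \<alpha> / 2 > 0 gives the right-hand side.\<close>
  also have "exp (4 * ln s + w) < exp 6 \<longleftrightarrow> 6 * s ^ 4 + \<alpha> * (2 * ln s - 3) < 0"
    using assms by (simp add: w_def field_simps) argo
  finally show ?thesis .
qed

lemma DERIV_kirchhoff_P:
  assumes "0 < s"
  shows "(kirchhoff_P lam mu rho0 has_real_derivative
    1 / rho0 * (3 * mu * s ^ 2 - mu + lam * ((1 - ln s) / s ^ 2))) (at s)"
  unfolding kirchhoff_P_def[abs_def] using assms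
  by (intro DERIV_cmult)
    (auto intro!: derivative_eq_intros simp: power2_eq_square algebra_simps)

lemma deriv_deriv_kirchhoff_P:
  assumes "0 < s"
  shows "deriv (deriv (kirchhoff_P lam mu rho0)) s
    = 1 / rho0 * (6 * mu * s + lam * ((2 * ln s - 3) / s ^ 3))"
proof -
  let ?D = "\<lambda>s. 1 / rho0 * (3 * mu * s ^ 2 - mu + lam * ((1 - ln s) / s ^ 2))"
  have "(?D has_real_derivative
      1 / rho0 * (6 * mu * s + lam * (((- 1 / s) * s ^ 2 - (1 - ln s) * (2 * s)) / (s ^ 2 * s ^ 2))))
      (at s)"
    using assms by (intro DERIV_cmult) (auto intro!: derivative_eq_intros simp: algebra_simps)
  also have "((- 1 / s) * s ^ 2 - (1 - ln s) * (2 * s)) / (s ^ 2 * s ^ 2) = (2 * ln s - 3) / s ^ 3"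
    using assms by (simp add: field_simps power2_eq_square power3_eq_cube)
  finally have D: "(?D has_real_derivative
      1 / rho0 * (6 * mu * s + lam * ((2 * ln s - 3) / s ^ 3))) (at s)" .
  \<comment> \<open>Differentiating \<open>deriv\<close> at \<open>s\<close> requires its formula on
    a whole neighbourhood of \<open>s\<close>. The formula \<open>?D\<close> is available for
    positive arguments, so the open half-line serves as that neighbourhood.\<close>
  have "(deriv (kirchhoff_P lam mu rho0) has_real_derivative
      1 / rho0 * (6 * mu * s + lam * ((2 * ln s - 3) / s ^ 3))) (at s)"
  proof (rule has_field_derivative_transform_within_open[OF D])
    show "open {0::real<..}" "s \<in> {0<..}" using assms by auto
    show "?D x = deriv (kirchhoff_P lam mu rho0) x" if "x \<in> {0<..}" for x
      using that by (intro DERIV_imp_deriv[symmetric] DERIV_kirchhoff_P) simp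
  qed
  then show ?thesis by (rule DERIV_imp_deriv)
qed

text \<open>Factoring the positive quantity mu / (rho0 s^3) out of the second derivative leaves an
  expression that depends on the parameters through lam / mu alone.\<close>

lemma deriv_deriv_kirchhoff_P_neg_iff:
  assumes "0 < mu" "0 < rho0" "0 < s"
  shows "deriv (deriv (kirchhoff_P lam mu rho0)) s < 0
    \<longleftrightarrow> 6 * s ^ 4 + lam / mu * (2 * ln s - 3) < 0"
proof -
  have "1 / rho0 * (6 * mu * s + lam * ((2 * ln s - 3) / s ^ 3))
      = mu / (rho0 * s ^ 3) * (6 * s ^ 4 + lam / mu * (2 * ln s - 3))"
    using assms by (simp add: field_simps eval_nat_numeral)
  moreover have "0 < mu / (rho0 * s ^ 3)" using assms by simp
  ultimately show ?thesis
    using assms by (simp only: deriv_deriv_kirchhoff_P mult_less_0_iff not_less_iff_gr_or_eq) (meson less_asym)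
qed

theorem mainTheorem5:
  fixes lam mu rho0 \<alpha> :: real
    and P :: "real \<Rightarrow> real"
  assumes "lam > 0" and "mu > 0" and "rho0 > 0"
    and "\<alpha> = lam / mu"
    and "P = kirchhoff_P lam mu rho0"
  shows "(\<forall>s>0. deriv (deriv P) s < 0 \<longleftrightarrow> s \<in> {0<..<s_crit \<alpha>})
    \<and> ((\<forall>s\<in>{0<..1}. deriv (deriv P) s < 0) \<longleftrightarrow> s_crit \<alpha> > 1)
    \<and> (s_crit \<alpha> > 1 \<longleftrightarrow> \<alpha> > 2)"
proof -
  have "0 < \<alpha>" using assms by simp
  have neg_iff: "deriv (deriv P) s < 0 \<longleftrightarrow> s < s_crit \<alpha>" if "0 < s" for s
    using deriv_deriv_kirchhoff_P_neg_iff[OF \<open>mu > 0\<close> \<open>rho0 > 0\<close> that]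
      less_s_crit_iff[OF \<open>0 < \<alpha>\<close> that] assms(4,5) by simp
  \<comment> \<open>The endpoint s = 1 belongs to the interval and gives the forward direction;
    conversely s \<le> 1 < \<open>s_crit \<alpha>\<close> for every s in it.\<close>
  then have "(\<forall>s\<in>{0<..1}. deriv (deriv P) s < 0) \<longleftrightarrow> s_crit \<alpha> > 1"
    by fastforce
  \<comment> \<open>At s = 1 the logarithm vanishes and the criterion reads 6 - 3 \<alpha> <
    0.\<close>
  moreover have "s_crit \<alpha> > 1 \<longleftrightarrow> \<alpha> > 2"
    using less_s_crit_iff[OF \<open>0 < \<alpha>\<close>, of 1] by auto
  ultimately show ?thesis
    using neg_iff by simp
qed

end
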